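(* Let $F=(F,\mathcal G_0,\nu)$ be a commutative supertropical semifield, let $V$ be a subspace of $F^{(n)}$ and let $B=\langle\ ,\ \rangle$ be a supertropical bilinear form on $V$. Assume that vectors $w_1,\dots,w_k\in V$ tropically span a nondegenerate subspace $W$ of $V$. If $|\widetilde G(w_1,\dots,w_k)|\in\mathcal G_0$, then $w_1,\dots,w_k$ are tropically dependent.
   Context: A semiring with ghosts is a triple $(R,\mathcal G_0,\nu)$ where $R$ is a semiring with $0,1$ such that $R\setminus\{0\}$ is closed under addition and multiplication, $\mathcal G_0\ni 0$ is an ideal (the ghost ideal), and $\nu:R\to\mathcal G_0$, $\nu(a)=a+a=:a^\nu$, is idempotent and preserves addition and multiplication. Put $\mathcal G=\mathcal G_0\setminus\{0\}$. It is a supertropical semiring if for nonzero $a,b$: $a+b=a^\nu$ whenever $a^\nu=b^\nu$, and $a+b\in\{a,b\}$ whenever $a^\nu\neq b^\nu$. It is a supertropical domain if $\mathcal T:=R\setminus\mathcal G_0$ (the tangible elements) is a multiplicative monoid and $\nu|_{\mathcal T}:\mathcal T\to\mathcal G$ is onto, and a supertropical semifield if moreover $\mathcal T$ is a group. For $a,b\in R$ write $a\models_{gs}b$ if $a=b+c$ for some $c\in\mathcal G_0$. $F^{(n)}$ has componentwise operations and ghost submodule $\mathcal G_0^{(n)}$; a subspace $V\subseteq F^{(n)}$ is a submodule, with ghost submodule $\mathcal H_0=V\cap\mathcal G_0^{(n)}$. For $v,w\in V$, $v\models_{gs}w$ means $v=w+h$ for some $h\in\mathcal H_0$. The subspace of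 $V$ tropically spanned by $w_1,\dots,w_k$ is the set of $v\in V$ with $v\models_{gs}\sum_{i\in I'}\alpha_iw_i$ for some (possibly empty) $I'\subseteq\{1,\dots,k\}$ and $\alpha_i\in\mathcal T$. Vectors $w_1,\dots,w_k$ are tropically dependent if $\sum_{i\in I'}\alpha_iw_i\in\mathcal H_0$ for some nonempty $I'\subseteq\{1,\dots,k\}$ and some $\alpha_i\in\mathcal T$. A supertropical bilinear form on $V$ is a function $B:V\times V\to F$, $B(v,w)=\langle v,w\rangle$, such that in each variable separately it is a linear functional: $\langle v_1+v_2,w\rangle\models_{gs}\langle v_1,w\rangle+\langle v_2,w\rangle$, $\langle v,w_1+w_2\rangle\models_{gs}\langle v,w_1\rangle+\langle v,w_2\rangle$, $\langle\alpha v,w\rangle=\alpha\langle v,w\rangle=\langle v,\alpha w\rangle$ for $\alpha\in F$, and $\langle\mathcal H_0,V\rangle\subseteq\mathcal G_0$, $\langle V,\mathcal H_0\rangle\subseteq\mathcal G_0$. For $W\subseteq V$, $W^{\perp\!\!\!\perp}=\{v\in V:\langle v,w\rangle\in\mathcal G_0\ \forall w\in W\}$; the subspace $W$ is nondegenerate if $W^{\perp\!\!\!\perp}\cap W\subseteq\mathcal H_0$. The Gram matrix $\widetilde G(w_1,\dots,w_k)$ is the $k\times k$ matrix with $(i,j)$ entry $\langle w_i,w_j\rangle$. The tropical determinant of an $n\times n$ matrix is the permanent $|A|=\sum_{\pi\in S_n}a_{\pi(1),1}\cdots a_{\pi(n),n}$. *)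

theory Defs
  imports "HOL-Analysis.Analysis"
begin

section \<open>Supertropical semirings and semifields\<close>

text \<open>
  The semiring \<open>R\<close> is the type \<open>'a\<close>.  The class \<open>semiring_1\<close> includes \<open>0 \<noteq> 1\<close>; this is
  no restriction for supertropical domains, since \<open>1\<close> is tangible and \<open>0\<close> is ghost.
\<close>

definition semiring_ideal :: "'a::semiring_1 set \<Rightarrow> bool" where
  "semiring_ideal I \<longleftrightarrow>
     0 \<in> I \<and> (\<forall>a\<in>I. \<forall>b\<in>I. a + b \<in> I) \<and> (\<forall>r. \<forall>a\<in>I. r * a \<in> I \<and> a * r \<in> I)"

locale semiring_with_ghosts =
  fixes G0 :: "'a::semiring_1 set"
    and nu :: "'a \<Rightarrow> 'a"
  assumes nonzero_add_closed: "a \<noteq> 0 \<Longrightarrow> b \<noteq> 0 \<Longrightarrow> a + b \<noteq> 0"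
    and nonzero_mult_closed: "a \<noteq> 0 \<Longrightarrow> b \<noteq> 0 \<Longrightarrow> a * b \<noteq> 0"
    and ghost_ideal: "semiring_ideal G0"
    and nu_ghost: "nu a \<in> G0"
    and nu_eq: "nu a = a + a"
    and nu_idem: "nu (nu a) = nu a"
    and nu_add: "nu (a + b) = nu a + nu b"
    and nu_mult: "nu (a * b) = nu a * nu b"

locale supertropical_semiring = semiring_with_ghosts +
  assumes add_nu_eq: "a \<noteq> 0 \<Longrightarrow> b \<noteq> 0 \<Longrightarrow> nu a = nu b \<Longrightarrow> a + b = nu a"
    and add_nu_neq: "a \<noteq> 0 \<Longrightarrow> b \<noteq> 0 \<Longrightarrow> nu a \<noteq> nu b \<Longrightarrow> a + b \<in> {a, b}"

definition tangible :: "'a set \<Rightarrow> 'a set" where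
  "tangible G0 = UNIV - G0"

locale supertropical_domain = supertropical_semiring +
  assumes one_tangible: "1 \<in> tangible G0"
    and mult_tangible: "a \<in> tangible G0 \<Longrightarrow> b \<in> tangible G0 \<Longrightarrow> a * b \<in> tangible G0"
    and nu_onto: "nu ` tangible G0 = G0 - {0}"

locale supertropical_semifield = supertropical_domain +
  assumes tangible_inverse:
    "a \<in> tangible G0 \<Longrightarrow> \<exists>b\<in>tangible G0. a * b = 1 \<and> b * a = 1"

definition ghost_surpasses :: "'a::semiring_1 set \<Rightarrow> 'a \<Rightarrow> 'a \<Rightarrow> bool" where
  "ghost_surpasses G0 a b \<longleftrightarrow> (\<exists>c\<in>G0. a = b + c)"

section \<open>Subspaces, tropical span and tropical dependence\<close>

definition subspace_of_vec :: "('a::semiring_1 ^ 'n) set \<Rightarrow> bool" where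
  "subspace_of_vec V \<longleftrightarrow>
     0 \<in> V \<and> (\<forall>v\<in>V. \<forall>w\<in>V. v + w \<in> V) \<and> (\<forall>\<alpha>. \<forall>v\<in>V. \<alpha> *s v \<in> V)"

definition ghost_submodule :: "'a::semiring_1 set \<Rightarrow> ('a ^ 'n) set \<Rightarrow> ('a ^ 'n) set" where
  "ghost_submodule G0 V = V \<inter> {v. \<forall>i. v $ i \<in> G0}"

definition vec_ghost_surpasses ::
    "'a::semiring_1 set \<Rightarrow> ('a ^ 'n) set \<Rightarrow> 'a ^ 'n \<Rightarrow> 'a ^ 'n \<Rightarrow> bool" where
  "vec_ghost_surpasses G0 V v w \<longleftrightarrow> (\<exists>h\<in>ghost_submodule G0 V. v = w + h)"

text \<open>A family \<open>w\<^sub>1, \<dots>, w\<^sub>k\<close> is given by the values of \<open>w\<close> on \<open>{1..k}\<close>.\<close>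

definition tropical_span ::
    "'a::semiring_1 set \<Rightarrow> ('a ^ 'n) set \<Rightarrow> nat \<Rightarrow> (nat \<Rightarrow> 'a ^ 'n) \<Rightarrow> ('a ^ 'n) set" where
  "tropical_span G0 V k w =
     {v \<in> V. \<exists>I \<alpha>. I \<subseteq> {1..k} \<and> (\<forall>i\<in>I. \<alpha> i \<in> tangible G0) \<and>
        vec_ghost_surpasses G0 V v (\<Sum>i\<in>I. \<alpha> i *s w i)}"

definition tropically_dependent ::
    "'a::semiring_1 set \<Rightarrow> ('a ^ 'n) set \<Rightarrow> nat \<Rightarrow> (nat \<Rightarrow> 'a ^ 'n) \<Rightarrow> bool" where
  "tropically_dependent G0 V k w \<longleftrightarrow>
     (\<exists>I \<alpha>. I \<noteq> {} \<and> I \<subseteq> {1..k} \<and> (\<forall>i\<in>I. \<alpha> i \<in> tangible G0) \<and>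
        (\<Sum>i\<in>I. \<alpha> i *s w i) \<in> ghost_submodule G0 V)"

section \<open>Supertropical bilinear forms\<close>

text \<open>
  Functionals and forms are total functions on \<open>'a ^ 'n\<close>; only their values on the subspace
  \<open>V\<close> are constrained or used.
\<close>

definition supertropical_functional ::
    "'a::semiring_1 set \<Rightarrow> ('a ^ 'n) set \<Rightarrow> ('a ^ 'n \<Rightarrow> 'a) \<Rightarrow> bool" where
  "supertropical_functional G0 V f \<longleftrightarrow>
     (\<forall>v\<^sub>1\<in>V. \<forall>v\<^sub>2\<in>V. ghost_surpasses G0 (f (v\<^sub>1 + v\<^sub>2)) (f v\<^sub>1 + f v\<^sub>2)) \<and>
     (\<forall>\<alpha>. \<forall>v\<in>V. f (\<alpha> *s v) = \<alpha> * f v) \<and>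
     (\<forall>v\<in>ghost_submodule G0 V. f v \<in> G0)"

definition supertropical_bilinear_form ::
    "'a::semiring_1 set \<Rightarrow> ('a ^ 'n) set \<Rightarrow> ('a ^ 'n \<Rightarrow> 'a ^ 'n \<Rightarrow> 'a) \<Rightarrow> bool" where
  "supertropical_bilinear_form G0 V B \<longleftrightarrow>
     (\<forall>w\<in>V. supertropical_functional G0 V (\<lambda>v. B v w)) \<and>
     (\<forall>v\<in>V. supertropical_functional G0 V (\<lambda>w. B v w))"

definition ghost_orthogonal ::
    "'a set \<Rightarrow> ('a ^ 'n) set \<Rightarrow> ('a ^ 'n \<Rightarrow> 'a ^ 'n \<Rightarrow> 'a) \<Rightarrow> ('a ^ 'n) set \<Rightarrow> ('a ^ 'n) set" where
  "ghost_orthogonal G0 V B W = {v \<in> V. \<forall>w\<in>W. B v w \<in> G0}"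

definition nondegenerate ::
    "'a::semiring_1 set \<Rightarrow> ('a ^ 'n) set \<Rightarrow> ('a ^ 'n \<Rightarrow> 'a ^ 'n \<Rightarrow> 'a) \<Rightarrow> ('a ^ 'n) set \<Rightarrow> bool" where
  "nondegenerate G0 V B W \<longleftrightarrow> ghost_orthogonal G0 V B W \<inter> W \<subseteq> ghost_submodule G0 V"

section \<open>Gram matrix and tropical determinant\<close>

text \<open>A \<open>k \<times> k\<close> matrix is a function of two indices, used on \<open>{1..k}\<close> only.\<close>

definition gram_matrix ::
    "('a ^ 'n \<Rightarrow> 'a ^ 'n \<Rightarrow> 'a) \<Rightarrow> (nat \<Rightarrow> 'a ^ 'n) \<Rightarrow> nat \<Rightarrow> nat \<Rightarrow> 'a" where
  "gram_matrix B w i j = B (w i) (w j)"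

definition tropical_det :: "nat \<Rightarrow> (nat \<Rightarrow> nat \<Rightarrow> 'a::comm_semiring_1) \<Rightarrow> 'a" where
  "tropical_det k A = (\<Sum>\<pi> | \<pi> permutes {1..k}. \<Prod>j = 1..k. A (\<pi> j) j)"

end

theory Submission
  imports Defs
begin

text \<open>
  Suppose that tangible coefficients \<open>\<alpha>\<^sub>i\<close>, \<open>i \<in> I \<noteq> {}\<close>, make the rows of the Gram matrix dependent,
  that is, \<open>\<Sum>\<^sub>i \<alpha>\<^sub>i \<langle>w\<^sub>i, w\<^sub>j\<rangle>\<close> is ghost for every \<open>j\<close>.  The vector \<open>v = \<Sum>\<^sub>i \<alpha>\<^sub>i w\<^sub>i\<close> lies in \<open>W\<close>.
  A functional respects sums up to a ghost summand, so \<open>v\<close> is ghost-orthogonal to every \<open>w\<^sub>j\<close> and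
  therefore to \<open>W\<close>; nondegeneracy makes \<open>v\<close> a ghost vector, and this is the required tropical
  dependence.

  What remains is a statement on matrices: a square matrix with ghost permanent has
  dependent rows (\<open>rows_dependent_if_det_ghost\<close>).  The classical candidates for the coefficients are
  the cofactors along one column, but they may be ghost.  The remedy is to replace each
  nonzero cofactor by a tangible element with the same \<open>\<nu>\<close>-value.  For this to be harmless, it must
  be seen that the resulting column sums are ghost because their dominating value occurs in two
  different rows or at a ghost matrix entry, never merely because a cofactor is ghost.

  For a column \<open>j\<close> that takes part in the cofactors this is an exchange argument
  (\<open>column_sum_ghost\<close>): a dominating term consists of an entry \<open>a\<^sub>i\<^sub>j\<close> and an optimal transversal of
  the other rows, which itself uses some \<open>a\<^sub>i\<^sub>'\<^sub>j\<close>.  Exchanging the two occurrences of column \<open>j\<close> gives an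
  equally large term in row \<open>i' \<noteq> i\<close>.

  For the omitted columns there are two cases.  If the permanent is not \<open>0\<close>, it is ghost because
  an optimal permutation passes through a ghost entry, or because there are two optimal
  permutations.  The omitted column is chosen as that of the ghost entry, or as one in which
  the two permutations differ.  If the permanent is \<open>0\<close>, then a largest partial
  transversal without zeros misses a row and a column; adding one missed row and taking cofactors
  over the columns of the transversal, the entries of every other column are \<open>0\<close> in all rows with
  nonzero cofactor, since otherwise the transversal could be enlarged.
\<close>

section \<open>The order given by ghost values\<close>

context supertropical_semiring
begin

text \<open>The order of the idempotent semiring of ghosts, where addition is maximum, pulled back along \<open>\<nu>\<close>.\<close>

definition nu_le :: "'a \<Rightarrow> 'a \<Rightarrow> bool"  (infix "\<preceq>" 50) where
  "a \<preceq> b \<longleftrightarrow> nu a + nu b = nu b"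

lemma nu_zero [simp]: "nu 0 = 0"
  by (simp add: nu_eq)

lemma nu_eq_zero_iff [simp]: "nu a = 0 \<longleftrightarrow> a = 0"
  using nonzero_add_closed[of a a] by (auto simp: nu_eq)

lemma zero_ghost [simp]: "0 \<in> G0"
  using ghost_ideal by (simp add: semiring_ideal_def)

lemma ghost_add: "a \<in> G0 \<Longrightarrow> b \<in> G0 \<Longrightarrow> a + b \<in> G0"
  using ghost_ideal by (simp add: semiring_ideal_def)

lemma ghost_mult_left: "a \<in> G0 \<Longrightarrow> r * a \<in> G0"
  using ghost_ideal by (simp add: semiring_ideal_def)

lemma ghost_sum: "(\<And>i. i \<in> S \<Longrightarrow> x i \<in> G0) \<Longrightarrow> sum x S \<in> G0"
  by (induction S rule: infinite_finite_induct) (auto intro: ghost_add)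

lemma nu_le_refl [simp]: "a \<preceq> a"
  by (metis nu_le_def nu_eq nu_idem)

lemma zero_nu_le [simp]: "0 \<preceq> a"
  by (simp add: nu_le_def)

lemma nu_le_trans: "a \<preceq> b \<Longrightarrow> b \<preceq> c \<Longrightarrow> a \<preceq> c"
  unfolding nu_le_def by (metis add.assoc)

lemma nu_le_antisym: "a \<preceq> b \<Longrightarrow> b \<preceq> a \<Longrightarrow> nu a = nu b"
  unfolding nu_le_def by (metis add.commute)

lemma nu_le_cong: "nu a = nu a' \<Longrightarrow> nu b = nu b' \<Longrightarrow> a \<preceq> b \<longleftrightarrow> a' \<preceq> b'"
  by (simp add: nu_le_def)

lemma nu_le_linear: "a \<preceq> b \<or> b \<preceq> a"
proof (cases "a = 0 \<or> b = 0 \<or> nu a = nu b")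
  case True
  then show ?thesis by (metis nu_le_def nu_le_refl zero_nu_le)
next
  case False
  then have "nu (a + b) \<in> {nu a, nu b}"
    using add_nu_neq[of a b] by auto
  then show ?thesis
    by (auto simp: nu_le_def nu_add add.commute)
qed

lemma nu_le_mult: "a \<preceq> b \<Longrightarrow> c \<preceq> d \<Longrightarrow> a * c \<preceq> b * d"
proof -
  assume "a \<preceq> b" "c \<preceq> d"
  then have "a * c \<preceq> b * c" "b * c \<preceq> b * d"
    by (metis nu_le_def nu_mult distrib_right) (metis \<open>c \<preceq> d\<close> nu_le_def nu_mult distrib_left)
  then show ?thesis by (rule nu_le_trans)
qed

lemma nu_le_nonzero: "a \<preceq> b \<Longrightarrow> a \<noteq> 0 \<Longrightarrow> b \<noteq> 0"
  by (auto simp: nu_le_def)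

lemma add_strictly_dominated:
  assumes "a \<preceq> b" "nu a \<noteq> nu b"
  shows "a + b = b"
proof (cases "a = 0")
  case False
  then have b: "b \<noteq> 0" using assms(1) nu_le_nonzero by blast
  have "a + b \<noteq> a"
    using assms by (metis nu_add nu_le_def)
  then show ?thesis using add_nu_neq[OF False b assms(2)] by simp
qed simp

lemma add_same_nu_ghost:
  assumes "nu a = nu b"
  shows "a + b = nu b"
proof (cases "a = 0 \<or> b = 0")
  case True
  then have "a = 0 \<and> b = 0" using assms nu_eq_zero_iff by metis
  then show ?thesis by simp
next
  case False
  then show ?thesis using assms add_nu_eq[of a b] by simp
qed

lemma finite_has_dominating:
  assumes "finite S" "S \<noteq> {}"
  obtains i where "i \<in> S" "\<And>j. j \<in> S \<Longrightarrow> x j \<preceq> x i"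
proof -
  from assms have "\<exists>i\<in>S. \<forall>j\<in>S. x j \<preceq> x i"
  proof (induction S rule: finite_ne_induct)
    case (insert i S)
    then obtain m where "m \<in> S" "\<forall>j\<in>S. x j \<preceq> x m" by blast
    with nu_le_linear[of "x i" "x m"] nu_le_trans show ?case
      by (metis insert_iff nu_le_refl)
  qed simp
  with that show thesis by blast
qed

text \<open>
  Strictly dominated summands are absorbed, so only the summands of largest \<open>\<nu>\<close>-value matter: a sum is
  ghost exactly when one of these is ghost or there are at least two of them.  In the second case
  the summands may be exchanged for others with the same \<open>\<nu>\<close>-values.
\<close>

lemma sum_ghost_if:
  assumes "finite S" "i \<in> S" and dom: "\<And>j. j \<in> S \<Longrightarrow> x j \<preceq> x i"
    and "x i \<in> G0 \<or> (\<exists>i'\<in>S. i' \<noteq> i \<and> nu (x i') = nu (x i))"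
  shows "sum x S \<in> G0"
proof -
  have absorb: "sum x T + z \<in> G0 \<and> nu (sum x T + z) = nu (x i)"
    if "finite T" "T \<subseteq> S" "z \<in> G0" "nu z = nu (x i)" for T z
    using that
  proof (induction T)
    case (insert j T)
    let ?s = "sum x T + z"
    have s: "?s \<in> G0" "nu ?s = nu (x i)" using insert by auto
    have "x j \<preceq> ?s" using dom[of j] insert.prems s(2) nu_le_cong[of "x j" "x j" ?s "x i"] by simp
    then have "x j + ?s \<in> G0 \<and> nu (x j + ?s) = nu ?s"
      using add_strictly_dominated[of "x j" ?s] add_same_nu_ghost[of "x j" ?s] s(1)
      by (cases "nu (x j) = nu ?s") (auto simp: nu_ghost nu_idem)
    then show ?case using insert.hyps s(2) by (simp add: add.assoc)
  qed auto
  show ?thesis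
  proof (cases "x i \<in> G0")
    case True
    have "sum x S = sum x (S - {i}) + x i"
      using assms(1,2) by (simp add: sum.remove add.commute)
    then show ?thesis using absorb[of "S - {i}" "x i"] True assms(1) by auto
  next
    case False
    then obtain i' where i': "i' \<in> S" "i' \<noteq> i" "nu (x i') = nu (x i)" using assms(4) by blast
    have "sum x S = x i + (x i' + sum x (S - {i} - {i'}))"
      using assms(1,2) i' by (simp add: sum.remove[of S i] sum.remove[of "S - {i}" i'])
    also have "\<dots> = sum x (S - {i} - {i'}) + (x i' + x i)"
      by (simp add: ac_simps)
    also have "x i' + x i = nu (x i)" by (rule add_same_nu_ghost[OF i'(3)])
    finally show ?thesis
      using absorb[of "S - {i} - {i'}" "nu (x i)"] assms(1) by (auto simp: nu_ghost nu_idem)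
  qed
qed

lemma sum_ghost_cases:
  assumes "finite S" "S \<noteq> {}" "sum x S \<in> G0"
  obtains i where "i \<in> S" "\<And>j. j \<in> S \<Longrightarrow> x j \<preceq> x i"
    and "x i \<in> G0 \<or> (\<exists>i'\<in>S. i' \<noteq> i \<and> nu (x i') = nu (x i))"
proof -
  obtain i where i: "i \<in> S" "\<And>j. j \<in> S \<Longrightarrow> x j \<preceq> x i"
    using finite_has_dominating[OF assms(1,2)] by metis
  have "x i \<in> G0" if single: "\<And>i'. i' \<in> S \<Longrightarrow> i' \<noteq> i \<Longrightarrow> nu (x i') \<noteq> nu (x i)"
  proof -
    have "sum x T + x i = x i" if "finite T" "T \<subseteq> S - {i}" for T
      using that
    proof (induction T)
      case (insert j T)
      then have "x j + x i = x i"
        using i(2) single by (intro add_strictly_dominated) auto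
      then show ?case using insert by (simp add: add.assoc)
    qed simp
    from this[of "S - {i}"] have "sum x S = x i"
      using assms(1) i(1) by (simp add: sum.remove add.commute)
    then show ?thesis using assms(3) by simp
  qed
  with that i show thesis by blast
qed

end

section \<open>Tangible cofactors\<close>

locale comm_supertropical_domain = supertropical_domain G0 nu
  for G0 :: "'a::comm_semiring_1 set" and nu :: "'a \<Rightarrow> 'a"
begin

lemma tangible_nonzero: "a \<in> tangible G0 \<Longrightarrow> a \<noteq> 0"
  by (auto simp: tangible_def)

lemma tangible_lift:
  assumes "a \<noteq> 0"
  obtains t where "t \<in> tangible G0" "nu t = nu a"
proof -
  have "nu a \<in> nu ` tangible G0" using assms by (simp add: nu_onto nu_ghost)
  with that show thesis by (metis imageE)
qed

lemma prod_ghost_has_ghost_factor: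
  assumes "prod x S \<in> G0"
  obtains i where "i \<in> S" "x i \<in> G0"
proof -
  have "prod x S \<in> tangible G0" if "\<forall>i\<in>S. x i \<in> tangible G0"
    using that
    by (induction S rule: infinite_finite_induct) (auto intro: mult_tangible one_tangible)
  with assms that show thesis by (auto simp: tangible_def)
qed

definition weight :: "('i \<Rightarrow> 'j \<Rightarrow> 'a) \<Rightarrow> ('j \<Rightarrow> 'i) \<Rightarrow> 'j set \<Rightarrow> 'a" where
  "weight A f C = (\<Prod>j\<in>C. A (f j) j)"

text \<open>
  The maximum of \<open>weight A f C\<close> over the bijections \<open>f\<close> from \<open>C\<close> to \<open>R - {i}\<close> has the \<open>\<nu>\<close>-value of the
  permanent of the submatrix with these rows and columns.  Maxima are used instead of permanents
  because only the \<open>\<nu>\<close>-value survives the passage to a tangible representative.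
\<close>

definition is_cofactor :: "('i \<Rightarrow> 'j \<Rightarrow> 'a) \<Rightarrow> 'i set \<Rightarrow> 'j set \<Rightarrow> 'i \<Rightarrow> 'a \<Rightarrow> bool" where
  "is_cofactor A R C i a \<longleftrightarrow> a \<in> tangible G0 \<and>
     (\<exists>f. bij_betw f C (R - {i}) \<and> nu a = nu (weight A f C)) \<and>
     (\<forall>f. bij_betw f C (R - {i}) \<longrightarrow> weight A f C \<preceq> a)"

definition cofactor :: "('i \<Rightarrow> 'j \<Rightarrow> 'a) \<Rightarrow> 'i set \<Rightarrow> 'j set \<Rightarrow> 'i \<Rightarrow> 'a" where
  "cofactor A R C i = (SOME a. is_cofactor A R C i a)"

text \<open>
  Tangible elements are nonzero, so these are the rows with nonzero cofactor; they carry the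
  coefficients of the dependence.
\<close>

definition cofactor_rows :: "('i \<Rightarrow> 'j \<Rightarrow> 'a) \<Rightarrow> 'i set \<Rightarrow> 'j set \<Rightarrow> 'i set" where
  "cofactor_rows A R C = {i \<in> R. \<exists>a. is_cofactor A R C i a}"

lemma is_cofactor_cofactor:
  "i \<in> cofactor_rows A R C \<Longrightarrow> is_cofactor A R C i (cofactor A R C i)"
  unfolding cofactor_rows_def cofactor_def by (auto intro: someI)

lemma cofactor_tangible: "i \<in> cofactor_rows A R C \<Longrightarrow> cofactor A R C i \<in> tangible G0"
  by (drule is_cofactor_cofactor) (simp add: is_cofactor_def)

lemma cofactor_attained:
  assumes "i \<in> cofactor_rows A R C"
  obtains f where "bij_betw f C (R - {i})" "nu (cofactor A R C i) = nu (weight A f C)"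
    "weight A f C \<noteq> 0"
proof -
  obtain f where "bij_betw f C (R - {i})" "nu (cofactor A R C i) = nu (weight A f C)"
    using is_cofactor_cofactor[OF assms] by (auto simp: is_cofactor_def)
  moreover from this have "weight A f C \<noteq> 0"
    using tangible_nonzero[OF cofactor_tangible[OF assms]] nu_eq_zero_iff by metis
  ultimately show thesis by (rule that)
qed

lemma weight_le_cofactor:
  "i \<in> cofactor_rows A R C \<Longrightarrow> bij_betw f C (R - {i}) \<Longrightarrow> weight A f C \<preceq> cofactor A R C i"
  by (drule is_cofactor_cofactor) (simp add: is_cofactor_def)

lemma mem_cofactor_rows:
  fixes A :: "'i \<Rightarrow> 'j \<Rightarrow> 'a"
  assumes fin: "finite R" "finite C"
    and i: "i \<in> R" and f: "bij_betw f C (R - {i})" "weight A f C \<noteq> 0"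
  shows "i \<in> cofactor_rows A R C"
proof -
  \<comment> \<open>A weight sees only the restriction to \<open>C\<close>, and there are finitely many restrictions.\<close>
  define S where "S = {g \<in> C \<rightarrow>\<^sub>E R. bij_betw g C (R - {i})}"
  have restrict_S: "restrict g C \<in> S" "weight A (restrict g C) C = weight A g C"
    if "bij_betw g C (R - {i})" for g
  proof -
    have "bij_betw (restrict g C) C (R - {i})"
      using that by (subst bij_betw_cong[where g = g]) auto
    then show "restrict g C \<in> S" by (auto simp: S_def bij_betw_def)
    show "weight A (restrict g C) C = weight A g C"
      unfolding weight_def by (rule prod.cong) auto
  qed
  have "finite (C \<rightarrow>\<^sub>E R)" using fin by (simp add: finite_PiE)
  then have "finite S" by (rule finite_subset[rotated]) (auto simp: S_def)
  moreover have "S \<noteq> {}" using restrict_S(1)[OF f(1)] by blast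
  ultimately obtain h where h: "h \<in> S" "\<And>g. g \<in> S \<Longrightarrow> weight A g C \<preceq> weight A h C"
    using finite_has_dominating[of S "\<lambda>g. weight A g C"] by metis
  have dom: "weight A g C \<preceq> weight A h C" if "bij_betw g C (R - {i})" for g
    using h(2)[OF restrict_S(1)[OF that]] restrict_S(2)[OF that] by simp
  have "weight A h C \<noteq> 0" using nu_le_nonzero[OF dom[OF f(1)] f(2)] .
  then obtain t where t: "t \<in> tangible G0" "nu t = nu (weight A h C)" by (rule tangible_lift)
  have "is_cofactor A R C i t"
    unfolding is_cofactor_def using t h(1) dom nu_le_cong[OF refl t(2)] by (auto simp: S_def)
  with i show ?thesis by (auto simp: cofactor_rows_def)
qed

text \<open>
  The exchange argument: in the matrix with the rows \<open>R\<close> and the columns \<open>C\<close> together with a second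
  copy of column \<open>j\<close>, exchanging the two copies turns an optimal transversal through \<open>(i, j)\<close>
  and \<open>(i', j)\<close> into one of the same weight that belongs to the summand of \<open>i'\<close> instead of \<open>i\<close>.
\<close>

lemma column_sum_ghost:
  fixes A :: "'i \<Rightarrow> 'j \<Rightarrow> 'a"
  assumes fin: "finite R" "finite C" and j: "j \<in> C"
  shows "(\<Sum>i\<in>cofactor_rows A R C. cofactor A R C i * A i j) \<in> G0"
proof -
  let ?I = "cofactor_rows A R C" and ?x = "\<lambda>i. cofactor A R C i * A i j"
  have sub: "?I \<subseteq> R" by (auto simp: cofactor_rows_def)
  have finI: "finite ?I" using fin(1) sub by (rule finite_subset[rotated])
  show ?thesis
  proof (cases "\<forall>i\<in>?I. ?x i = 0")
    case True
    then show ?thesis by simp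
  next
    case False
    then have "?I \<noteq> {}" by blast
    then obtain i where i: "i \<in> ?I" and dom: "\<And>l. l \<in> ?I \<Longrightarrow> ?x l \<preceq> ?x i"
      using finite_has_dominating[OF finI, of ?x] by metis
    have xi: "?x i \<noteq> 0" using False dom nu_le_nonzero by blast
    obtain f where f: "bij_betw f C (R - {i})" "nu (cofactor A R C i) = nu (weight A f C)"
      "weight A f C \<noteq> 0" using cofactor_attained[OF i] .
    define i' where "i' = f j"
    define g where "g = f(j := i)"
    have i': "i' \<in> R" "i' \<noteq> i" using f(1) j by (auto simp: i'_def bij_betw_def)
    have iR: "i \<in> R" using i sub by blast
    have g: "bij_betw g C (R - {i'})"
      using f(1) j iR unfolding g_def i'_def bij_betw_def inj_on_def
      by (auto simp: image_iff)
    have "weight A g C = A i j * weight A f (C - {j})"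
      unfolding weight_def using fin(2) j
      by (subst prod.remove[OF fin(2) j]) (auto simp: g_def intro!: arg_cong2[of _ _ _ _ "(*)"] prod.cong)
    moreover have "weight A f C = A i' j * weight A f (C - {j})"
      unfolding weight_def i'_def by (rule prod.remove[OF fin(2) j])
    ultimately have swap: "weight A g C * A i' j = weight A f C * A i j"
      by (simp add: ac_simps)
    have "A i j \<noteq> 0" using xi by auto
    then have "weight A g C \<noteq> 0"
      using nonzero_mult_closed[OF f(3)] swap by (metis mult_zero_left)
    then have i'I: "i' \<in> ?I" using mem_cofactor_rows[OF fin i'(1) g] by blast
    have "?x i \<preceq> ?x i'"
    proof -
      have "nu (?x i) = nu (weight A g C * A i' j)"
        by (simp only: swap nu_mult f(2))
      then show ?thesis
        using nu_le_mult[OF weight_le_cofactor[OF i'I g] nu_le_refl[of "A i' j"]]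
        by (simp add: nu_le_def)
    qed
    then have "nu (?x i') = nu (?x i)" using dom[OF i'I] by (rule nu_le_antisym[rotated])
    then show ?thesis
      using i'I i'(2) sum_ghost_if[of ?I i ?x, OF finI i dom] by blast
  qed
qed

section \<open>Matrices with ghost permanent\<close>

text \<open>
  The cofactors are taken along one column \<open>j0\<close>.  The exchange argument does not apply to \<open>j0\<close>; there the
  column sum expands the permanent, and \<open>j0\<close> is chosen so that the reason why the permanent is ghost
  remains visible in that expansion after the cofactors have been made tangible.
\<close>

lemma rows_dependent_if_det_nonzero:
  fixes A :: "nat \<Rightarrow> nat \<Rightarrow> 'a"
  assumes ghost: "tropical_det k A \<in> G0" and nonzero: "tropical_det k A \<noteq> 0"
  obtains I \<alpha> where "I \<noteq> {}" "I \<subseteq> {1..k}" "\<And>i. i \<in> I \<Longrightarrow> \<alpha> i \<in> tangible G0"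
    "\<And>j. j \<in> {1..k} \<Longrightarrow> (\<Sum>i\<in>I. \<alpha> i * A i j) \<in> G0"
proof -
  let ?K = "{1..k}"
  let ?P = "{\<pi>. \<pi> permutes ?K}"
  let ?t = "\<lambda>\<pi>. weight A \<pi> ?K"
  have det: "tropical_det k A = sum ?t ?P" by (simp add: tropical_det_def weight_def)
  have P: "finite ?P" "?P \<noteq> {}" using permutes_id[of ?K] by (blast intro: finite_permutations)+
  obtain \<pi> where \<pi>: "\<pi> \<in> ?P" and opt: "\<And>\<tau>. \<tau> \<in> ?P \<Longrightarrow> ?t \<tau> \<preceq> ?t \<pi>"
    and two: "?t \<pi> \<in> G0 \<or> (\<exists>\<pi>'\<in>?P. \<pi>' \<noteq> \<pi> \<and> nu (?t \<pi>') = nu (?t \<pi>))"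
    using sum_ghost_cases[OF P ghost[unfolded det]] by metis
  obtain \<rho> where "\<rho> \<in> ?P" "?t \<rho> \<noteq> 0" using nonzero unfolding det by (meson sum.neutral)
  then have t\<pi>: "?t \<pi> \<noteq> 0" using opt nu_le_nonzero by blast
  have "\<exists>j0\<in>?K. A (\<pi> j0) j0 \<in> G0 \<or> (\<exists>\<pi>'\<in>?P. \<pi>' j0 \<noteq> \<pi> j0 \<and> nu (?t \<pi>') = nu (?t \<pi>))"
  proof (cases "?t \<pi> \<in> G0")
    case True
    then show ?thesis unfolding weight_def by (rule prod_ghost_has_ghost_factor) blast
  next
    case False
    then obtain \<pi>' where \<pi>': "\<pi>' \<in> ?P" "\<pi>' \<noteq> \<pi>" "nu (?t \<pi>') = nu (?t \<pi>)" using two by blast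
    then obtain j0 where "\<pi>' j0 \<noteq> \<pi> j0" by blast
    moreover have "j0 \<in> ?K"
      using calculation \<pi> \<pi>'(1) permutes_not_in by (metis mem_Collect_eq)
    ultimately show ?thesis using \<pi>' by blast
  qed
  then obtain j0 where j0: "j0 \<in> ?K"
    and two_j0: "A (\<pi> j0) j0 \<in> G0 \<or> (\<exists>\<pi>'\<in>?P. \<pi>' j0 \<noteq> \<pi> j0 \<and> nu (?t \<pi>') = nu (?t \<pi>))" by blast
  define C where "C = ?K - {j0}"
  define I where "I = cofactor_rows A ?K C"
  define \<alpha> where "\<alpha> = cofactor A ?K C"
  define x where "x i = \<alpha> i * A i j0" for i
  have finC: "finite C" by (simp add: C_def)
  have IK: "I \<subseteq> ?K" by (auto simp: I_def cofactor_rows_def)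
  then have finI: "finite I" by (rule finite_subset) simp
  have split: "?t f = weight A f C * A (f j0) j0" for f
    unfolding weight_def C_def by (subst prod.remove[OF _ j0]) (auto simp: mult.commute)
  \<comment> \<open>Expansion along column \<open>j0\<close>: the summand of row \<open>i\<close> is the best permutation with \<open>j0 \<mapsto> i\<close>.\<close>
  have row: "\<tau> j0 \<in> I" "?t \<tau> \<preceq> x (\<tau> j0)" if \<tau>: "\<tau> \<in> ?P" "?t \<tau> \<noteq> 0" for \<tau>
  proof -
    have "bij_betw \<tau> ?K ?K" using \<tau>(1) by (simp add: permutes_imp_bij)
    then have b: "bij_betw \<tau> C (?K - {\<tau> j0})"
      unfolding C_def using j0 bij_betw_apply[of \<tau> ?K ?K j0]
      by (intro bij_betw_DiffI) (auto simp: bij_betw_def)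
    have "weight A \<tau> C \<noteq> 0" using \<tau>(2) split[of \<tau>] by auto
    moreover have "\<tau> j0 \<in> ?K" using \<tau>(1) j0 permutes_in_image[of \<tau> ?K j0] by blast
    ultimately show I: "\<tau> j0 \<in> I"
      unfolding I_def by (intro mem_cofactor_rows[OF _ finC _ b]) auto
    show "?t \<tau> \<preceq> x (\<tau> j0)"
      unfolding split x_def \<alpha>_def
      by (intro nu_le_mult weight_le_cofactor b nu_le_refl I[unfolded I_def])
  qed
  have upper: "x i \<preceq> ?t \<pi>" if i: "i \<in> I" for i
  proof -
    obtain f where f: "bij_betw f C (?K - {i})" "nu (\<alpha> i) = nu (weight A f C)"
      using cofactor_attained[OF i[unfolded I_def]] unfolding \<alpha>_def by metis
    define \<tau> where "\<tau> l = (if l = j0 then i else if l \<in> ?K then f l else l)" for l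
    have "bij_betw \<tau> C (?K - {i})"
      using f(1) by (subst bij_betw_cong[where g = f]) (auto simp: \<tau>_def C_def)
    then have "bij_betw \<tau> (insert j0 C) (insert i (?K - {i}))"
      using notIn_Un_bij_betw[of j0 C \<tau> "?K - {i}"] by (simp add: \<tau>_def C_def)
    then have "bij_betw \<tau> ?K ?K"
      using j0 i IK by (simp add: C_def insert_absorb subset_iff)
    then have P\<tau>: "\<tau> \<in> ?P"
      unfolding mem_Collect_eq by (rule bij_imp_permutes) (use j0 in \<open>auto simp: \<tau>_def\<close>)
    have "weight A \<tau> C = weight A f C"
      unfolding weight_def by (rule prod.cong) (auto simp: \<tau>_def C_def)
    then have "nu (?t \<tau>) = nu (x i)"
      using split[of \<tau>] f(2) by (simp add: x_def nu_mult \<tau>_def)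
    then show ?thesis using opt[OF P\<tau>] nu_le_cong by blast
  qed
  define i where "i = \<pi> j0"
  have i: "i \<in> I" "?t \<pi> \<preceq> x i" using row[OF \<pi> t\<pi>] by (simp_all add: i_def)
  have dom: "x l \<preceq> x i" if "l \<in> I" for l using upper[OF that] i(2) nu_le_trans by blast
  have "x i \<in> G0 \<or> (\<exists>i'\<in>I. i' \<noteq> i \<and> nu (x i') = nu (x i))"
    using two_j0
  proof
    assume "A (\<pi> j0) j0 \<in> G0"
    then show ?thesis by (simp add: x_def i_def ghost_mult_left)
  next
    assume "\<exists>\<pi>'\<in>?P. \<pi>' j0 \<noteq> \<pi> j0 \<and> nu (?t \<pi>') = nu (?t \<pi>)"
    then obtain \<pi>' where \<pi>': "\<pi>' \<in> ?P" "\<pi>' j0 \<noteq> i" "nu (?t \<pi>') = nu (?t \<pi>)"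
      by (auto simp: i_def)
    have "?t \<pi>' \<noteq> 0" using \<pi>'(3) t\<pi> nu_eq_zero_iff by metis
    note r = row[OF \<pi>'(1) this]
    have "x i \<preceq> x (\<pi>' j0)"
      using upper[OF i(1)] r(2) nu_le_cong[OF refl \<pi>'(3)] nu_le_trans by blast
    with dom[OF r(1)] have "nu (x (\<pi>' j0)) = nu (x i)" by (rule nu_le_antisym)
    then show ?thesis using r(1) \<pi>'(2) by blast
  qed
  then have "sum x I \<in> G0" by (intro sum_ghost_if[of I i x] finI i(1) dom)
  then have "(\<Sum>i\<in>I. \<alpha> i * A i j) \<in> G0" if "j \<in> ?K" for j
    using column_sum_ghost[OF _ finC, of ?K j A] that
    by (cases "j = j0") (auto simp: x_def I_def \<alpha>_def C_def)
  moreover have "I \<noteq> {}" using i(1) by blast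
  moreover have "\<alpha> l \<in> tangible G0" if "l \<in> I" for l
    using that unfolding I_def \<alpha>_def by (rule cofactor_tangible)
  ultimately show thesis using that[of I \<alpha>] IK by simp
qed

text \<open>
  With a largest partial transversal \<open>f\<close> on the columns \<open>C\<close> and one further row \<open>r\<close>, there is one row more
  than columns.  Row \<open>r\<close> has the nonzero cofactor \<open>weight A f C\<close> or a larger one, so the dependence is
  not trivial, and maximality makes all columns outside \<open>C\<close> vanish on the rows that are used.
\<close>

lemma rows_dependent_if_det_zero:
  fixes A :: "nat \<Rightarrow> nat \<Rightarrow> 'a"
  assumes zero: "tropical_det k A = 0"
  obtains I \<alpha> where "I \<noteq> {}" "I \<subseteq> {1..k}" "\<And>i. i \<in> I \<Longrightarrow> \<alpha> i \<in> tangible G0"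
    "\<And>j. j \<in> {1..k} \<Longrightarrow> (\<Sum>i\<in>I. \<alpha> i * A i j) \<in> G0"
proof -
  let ?K = "{1..k}"
  have no_perm: "weight A \<pi> ?K = 0" if "\<pi> permutes ?K" for \<pi>
  proof (rule ccontr)
    \<comment> \<open>A sum with a nonzero summand is nonzero, because nonzero elements are closed under addition.\<close>
    assume nz: "weight A \<pi> ?K \<noteq> 0"
    have "tropical_det k A = weight A \<pi> ?K + (\<Sum>\<tau>\<in>{\<pi>. \<pi> permutes ?K} - {\<pi>}. weight A \<tau> ?K)"
      unfolding tropical_det_def weight_def
      using that by (intro sum.remove) (auto intro: finite_permutations)
    with zero nz nonzero_add_closed show False by (metis add.right_neutral)
  qed
  define partial where "partial C f \<longleftrightarrow>
    C \<subseteq> ?K \<and> inj_on f C \<and> f ` C \<subseteq> ?K \<and> weight A f C \<noteq> 0" for C f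
  have "partial {} id" by (simp add: partial_def weight_def)
  then have "\<exists>f. partial {} f" by blast
  moreover have "\<forall>C. (\<exists>f. partial C f) \<longrightarrow> card C < Suc k"
    using card_mono[of ?K] by (auto simp: partial_def less_Suc_eq_le)
  ultimately have "\<exists>C. (\<exists>f. partial C f) \<and> (\<forall>D. (\<exists>f. partial D f) \<longrightarrow> card D \<le> card C)"
    by (rule ex_has_greatest_nat[where P = "\<lambda>C. \<exists>f. partial C f" and f = card])
  then obtain C where C: "\<exists>f. partial C f" and
    max: "\<And>D. \<exists>f. partial D f \<Longrightarrow> card D \<le> card C" by blast
  obtain f where f: "C \<subseteq> ?K" "inj_on f C" "f ` C \<subseteq> ?K" "weight A f C \<noteq> 0"
    using C by (auto simp: partial_def)
  have finC: "finite C" using f(1) finite_subset by blast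
  have "f ` C \<noteq> ?K"
  proof
    assume onto: "f ` C = ?K"
    have "C = ?K"
      using card_subset_eq[OF _ f(1)] card_image[OF f(2)] onto by simp
    define \<pi> where "\<pi> l = (if l \<in> ?K then f l else l)" for l
    have "bij_betw \<pi> ?K ?K"
      using f(2) onto \<open>C = ?K\<close>
      by (subst bij_betw_cong[where g = f]) (auto simp: \<pi>_def bij_betw_def)
    then have "\<pi> permutes ?K" by (rule bij_imp_permutes) (auto simp: \<pi>_def)
    moreover have "weight A \<pi> ?K = weight A f C"
      unfolding weight_def \<open>C = ?K\<close> by (rule prod.cong) (auto simp: \<pi>_def)
    ultimately show False using no_perm f(4) by simp
  qed
  then obtain r where r: "r \<in> ?K" "r \<notin> f ` C" using f(3) by blast
  define R where "R = insert r (f ` C)"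
  have R: "finite R" "R \<subseteq> ?K" "r \<in> R" using finC f(3) r(1) by (auto simp: R_def)
  define I where "I = cofactor_rows A R C"
  define \<alpha> where "\<alpha> = cofactor A R C"
  have "R - {r} = f ` C" using r(2) by (auto simp: R_def)
  then have "r \<in> I"
    unfolding I_def using f(2,4) R finC by (intro mem_cofactor_rows[of R C r f])
      (auto simp: bij_betw_def)
  have IR: "I \<subseteq> R" by (auto simp: I_def cofactor_rows_def)
  have outside: "A i j = 0" if i: "i \<in> I" and j: "j \<in> ?K - C" for i j
  proof (rule ccontr)
    assume nz: "A i j \<noteq> 0"
    obtain g where g: "bij_betw g C (R - {i})" "weight A g C \<noteq> 0"
      using cofactor_attained[OF i[unfolded I_def]] by metis
    define h where "h = g(j := i)"
    have "weight A h C = weight A g C"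
      unfolding weight_def by (rule prod.cong) (use j in \<open>auto simp: h_def\<close>)
    then have "weight A h (insert j C) = A i j * weight A g C"
      using finC j by (simp add: weight_def h_def)
    then have "weight A h (insert j C) \<noteq> 0" using nonzero_mult_closed[OF nz g(2)] by simp
    moreover have "inj_on h (insert j C)" "h ` insert j C \<subseteq> ?K"
    proof -
      have gC: "inj_on g C" "g ` C = R - {i}" using g(1) by (auto simp: bij_betw_def)
      have hC: "h ` C = g ` C" by (rule image_cong) (use j in \<open>auto simp: h_def\<close>)
      have "inj_on h C" using gC(1) j by (subst inj_on_cong[where g = g]) (auto simp: h_def)
      moreover have "h j = i" by (simp add: h_def)
      moreover have "i \<notin> h ` (C - {j})" using hC gC(2) by blast
      ultimately show "inj_on h (insert j C)" by simp
      have "h ` insert j C = insert i (R - {i})" using hC gC(2) \<open>h j = i\<close> by simp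
      also have "\<dots> = R" using subsetD[OF IR i] by (rule insert_Diff)
      finally show "h ` insert j C \<subseteq> ?K" using R(2) by simp
    qed
    ultimately have "partial (insert j C) h" using f(1) j by (auto simp: partial_def)
    then have "card (insert j C) \<le> card C" using max by blast
    then show False using finC j by simp
  qed
  have "(\<Sum>i\<in>I. \<alpha> i * A i j) \<in> G0" if "j \<in> ?K" for j
    using column_sum_ghost[OF R(1) finC, of j A] outside that
    by (cases "j \<in> C") (auto simp: I_def \<alpha>_def)
  moreover have "I \<noteq> {}" "I \<subseteq> ?K" using \<open>r \<in> I\<close> IR R(2) by blast+
  moreover have "\<alpha> l \<in> tangible G0" if "l \<in> I" for l
    using that unfolding I_def \<alpha>_def by (rule cofactor_tangible)
  ultimately show thesis using that[of I \<alpha>] by simp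
qed

lemma rows_dependent_if_det_ghost:
  fixes A :: "nat \<Rightarrow> nat \<Rightarrow> 'a"
  assumes "tropical_det k A \<in> G0"
  obtains I \<alpha> where "I \<noteq> {}" "I \<subseteq> {1..k}" "\<And>i. i \<in> I \<Longrightarrow> \<alpha> i \<in> tangible G0"
    "\<And>j. j \<in> {1..k} \<Longrightarrow> (\<Sum>i\<in>I. \<alpha> i * A i j) \<in> G0"
proof (cases "tropical_det k A = 0")
  case True
  then show thesis by (rule rows_dependent_if_det_zero) (rule that)
next
  case False
  with assms show thesis by (rule rows_dependent_if_det_nonzero) (rule that)
qed

section \<open>Functionals on linear combinations\<close>

lemma subspace_sum:
  assumes "subspace_of_vec V" "\<And>i. i \<in> I \<Longrightarrow> w i \<in> V"
  shows "(\<Sum>i\<in>I. \<alpha> i *s w i) \<in> V"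
  using assms(2)
  by (induction I rule: infinite_finite_induct) (use assms(1) in \<open>auto simp: subspace_of_vec_def\<close>)

lemma functional_sum:
  assumes V: "subspace_of_vec V" and f: "supertropical_functional G0 V f"
    and "finite I" "\<And>i. i \<in> I \<Longrightarrow> w i \<in> V"
  shows "ghost_surpasses G0 (f (\<Sum>i\<in>I. \<alpha> i *s w i)) (\<Sum>i\<in>I. \<alpha> i * f (w i))"
  using assms(3,4)
proof (induction I)
  case empty
  \<comment> \<open>Additivity says nothing about the empty sum; homogeneity at the scalar \<open>0\<close> gives \<open>f 0 = 0\<close>.\<close>
  have "f (0 *s 0) = 0 * f 0"
    using V f by (simp only: supertropical_functional_def subspace_of_vec_def)
  then show ?case by (auto simp: ghost_surpasses_def intro: bexI[of _ 0])
next
  case (insert i I)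
  let ?v = "\<Sum>i\<in>I. \<alpha> i *s w i" and ?s = "\<Sum>i\<in>I. \<alpha> i * f (w i)"
  obtain c where c: "c \<in> G0" "f ?v = ?s + c"
    using insert by (auto simp: ghost_surpasses_def)
  have "?v \<in> V" "\<alpha> i *s w i \<in> V"
    using V insert.prems subspace_sum[OF V, of I w \<alpha>] by (auto simp: subspace_of_vec_def)
  then obtain d where d: "d \<in> G0" "f (\<alpha> i *s w i + ?v) = f (\<alpha> i *s w i) + f ?v + d"
    using f unfolding supertropical_functional_def ghost_surpasses_def by blast
  have "f (\<alpha> i *s w i) = \<alpha> i * f (w i)"
    using f insert.prems by (simp add: supertropical_functional_def)
  then have "f (\<Sum>i\<in>insert i I. \<alpha> i *s w i) = (\<Sum>i\<in>insert i I. \<alpha> i * f (w i)) + (c + d)"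
    using insert.hyps c(2) d(2) by (simp add: ac_simps)
  then show ?case using ghost_add[OF c(1) d(1)] by (auto simp: ghost_surpasses_def)
qed

lemma functional_sum_ghost:
  assumes "subspace_of_vec V" "supertropical_functional G0 V f"
    and "finite I" "\<And>i. i \<in> I \<Longrightarrow> w i \<in> V" "(\<Sum>i\<in>I. \<alpha> i * f (w i)) \<in> G0"
  shows "f (\<Sum>i\<in>I. \<alpha> i *s w i) \<in> G0"
  using functional_sum[of V f I w \<alpha>, OF assms(1-4)] assms(5) ghost_add
  by (auto simp: ghost_surpasses_def)

lemma functional_ghost_on_span:
  assumes V: "subspace_of_vec V" and f: "supertropical_functional G0 V f"
    and w: "\<forall>i\<in>{1..k}. w i \<in> V" and ghost: "\<And>j. j \<in> {1..k} \<Longrightarrow> f (w j) \<in> G0"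
    and u: "u \<in> tropical_span G0 V k w"
  shows "f u \<in> G0"
proof -
  obtain J \<beta> h where J: "J \<subseteq> {1..k}" and h: "h \<in> ghost_submodule G0 V"
    and u_eq: "u = (\<Sum>j\<in>J. \<beta> j *s w j) + h"
    using u by (auto simp: tropical_span_def vec_ghost_surpasses_def)
  let ?s = "\<Sum>j\<in>J. \<beta> j *s w j"
  have finJ: "finite J" using J finite_subset by blast
  have wJ: "w j \<in> V" if "j \<in> J" for j using w J that by blast
  have s: "f ?s \<in> G0"
    using ghost J by (intro functional_sum_ghost[OF V f finJ wJ] ghost_sum ghost_mult_left) auto
  have "f h \<in> G0" using f h by (simp add: supertropical_functional_def)
  moreover have "?s \<in> V" "h \<in> V"
    using subspace_sum[of V J w \<beta>, OF V wJ] h by (simp_all add: ghost_submodule_def)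
  then obtain c where "c \<in> G0" "f u = f ?s + f h + c"
    using f unfolding u_eq supertropical_functional_def ghost_surpasses_def by blast
  ultimately show ?thesis using s by (auto intro: ghost_add)
qed

end

section \<open>Gram matrices of nondegenerate spans\<close>

theorem theorem7p10:
  fixes G0 :: "'a::comm_semiring_1 set"
    and nu :: "'a \<Rightarrow> 'a"
    and V W :: "('a ^ 'n) set"
    and B :: "'a ^ 'n \<Rightarrow> 'a ^ 'n \<Rightarrow> 'a"
    and k :: nat
    and w :: "nat \<Rightarrow> 'a ^ 'n"
  assumes "supertropical_semifield G0 nu"
    and "subspace_of_vec V"
    and "supertropical_bilinear_form G0 V B"
    and "\<forall>i\<in>{1..k}. w i \<in> V"
    and "W = tropical_span G0 V k w"
    and "nondegenerate G0 V B W"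
    and "tropical_det k (gram_matrix B w) \<in> G0"
  shows "tropically_dependent G0 V k w"
proof -
  interpret supertropical_semifield G0 nu by (rule assms(1))
  interpret comm_supertropical_domain G0 nu ..
  obtain I \<alpha> where I: "I \<noteq> {}" "I \<subseteq> {1..k}" and \<alpha>: "\<And>i. i \<in> I \<Longrightarrow> \<alpha> i \<in> tangible G0"
    and col: "\<And>j. j \<in> {1..k} \<Longrightarrow> (\<Sum>i\<in>I. \<alpha> i * B (w i) (w j)) \<in> G0"
    by (rule rows_dependent_if_det_ghost[OF assms(7), unfolded gram_matrix_def]) (rule that)
  have finI: "finite I" using I(2) finite_subset by blast
  have wI: "w i \<in> V" if "i \<in> I" for i using assms(4) I(2) that by blast
  let ?v = "\<Sum>i\<in>I. \<alpha> i *s w i"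
  have v: "?v \<in> V" using subspace_sum[OF assms(2) wI] .
  have left: "supertropical_functional G0 V (\<lambda>v. B v u)"
    and right: "supertropical_functional G0 V (B u)" if "u \<in> V" for u
    using assms(3) that by (auto simp: supertropical_bilinear_form_def)
  have "B ?v (w j) \<in> G0" if "j \<in> {1..k}" for j
    using functional_sum_ghost[OF assms(2) left finI wI col[OF that]] assms(4) that by blast
  then have "B ?v u \<in> G0" if "u \<in> W" for u
    using functional_ghost_on_span[OF assms(2) right[OF v] assms(4)] that assms(5) by blast
  then have "?v \<in> ghost_orthogonal G0 V B W" using v by (simp add: ghost_orthogonal_def)
  moreover have "?v \<in> W"
  proof -
    have "0 \<in> ghost_submodule G0 V"
      using assms(2) by (simp add: ghost_submodule_def subspace_of_vec_def)
    then have "vec_ghost_surpasses G0 V ?v ?v"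
      unfolding vec_ghost_surpasses_def by (intro bexI[of _ 0]) simp_all
    then show ?thesis using v I(2) \<alpha> unfolding assms(5) tropical_span_def by blast
  qed
  ultimately have "?v \<in> ghost_submodule G0 V"
    using assms(6) by (auto simp: nondegenerate_def)
  then show ?thesis using I \<alpha> unfolding tropically_dependent_def by blast
qed

end
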